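(* Fix an integer $k\ge 1$. For every integer $n\ge 0$, the number of partitions of $n$ satisfying condition (P) equals the number of partitions of $n$ satisfying condition (S), where: (P) every part is either even or $\equiv -1 \pmod{2k+2}$. (S) both of the following hold: - an odd part $2j+1$ is never immediately adjacent to any of $2j,2j-2,\dots,2j-2k+2$ (the $k$ even numbers preceding it); - (initial condition, implied by a fictitious zero) the smallest part is not equal to any of $1,3,\dots,2k-1$. Moreover, the generating function of the partitions satisfying (P) is the periodic infinite product $\prod_m (1-q^m)^{-1}$ over all $m\ge1$ with $m$ even or $m\equiv-1\pmod{2k+2}$; and a partition satisfies (S) if and only if its conjugate satisfies the following condition (C): (C) if a part appears exactly $1$, $3$, $\dots$, or $2k-1$ times, then there are an odd number of parts strictly greater than it.
   Context: Partitions $\lambda=(\lambda_1\ge\lambda_2\ge\dots\ge\lambda_r)$ have positive integer parts. Two parts are (immediately) adjacent if they are $\lambda_i,\lambda_{i+1}$ for some $1\le i<r$. The initial condition is "implied by a fictitious zero" if it is what the adjacency conditions impose when one part equal to $0$ is appended to the partition. Numbers of parts are counted with multiplicity. The conjugate of a partition is obtained by transposing its Ferrers diagram. *)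

theory Defs
  imports "HOL-Analysis.Analysis" "HOL-Number_Theory.Cong"
begin

definition is_partition :: "nat list \<Rightarrow> bool" where
  "is_partition xs \<longleftrightarrow> sorted_wrt (\<ge>) xs \<and> (\<forall>x\<in>set xs. 0 < x)"

definition partitions_of :: "nat \<Rightarrow> nat list set" where
  "partitions_of n = {xs. is_partition xs \<and> sum_list xs = n}"

definition ferrers :: "nat list \<Rightarrow> (nat \<times> nat) set" where
  "ferrers xs = {(i, j). i < length xs \<and> j < xs ! i}"

definition conjugate_partition :: "nat list \<Rightarrow> nat list" where
  "conjugate_partition xs = (THE ys. is_partition ys \<and> ferrers ys = (ferrers xs)\<inverse>)"

definition allowed_part :: "nat \<Rightarrow> nat \<Rightarrow> bool" where
  "allowed_part k m \<longleftrightarrow> even m \<or> [int m = - 1] (mod int (2 * k + 2))"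

definition cond_P :: "nat \<Rightarrow> nat list \<Rightarrow> bool" where
  "cond_P k xs \<longleftrightarrow> (\<forall>m\<in>set xs. allowed_part k m)"

definition adjacent_parts :: "nat list \<Rightarrow> nat \<Rightarrow> nat \<Rightarrow> bool" where
  "adjacent_parts xs a b \<longleftrightarrow>
     (\<exists>i. Suc i < length xs \<and>
        (xs ! i = a \<and> xs ! Suc i = b \<or> xs ! i = b \<and> xs ! Suc i = a))"

text \<open>The guard \<open>i \<le> j\<close> only keeps the subtraction on naturals from truncating: the
  even numbers it leaves out are negative, so they cannot be parts.\<close>

definition adjacency_condition :: "nat \<Rightarrow> nat list \<Rightarrow> bool" where
  "adjacency_condition k xs \<longleftrightarrow>
     (\<forall>j i. i < k \<and> i \<le> j \<longrightarrow> \<not> adjacent_parts xs (2 * j + 1) (2 * j - 2 * i))"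

text \<open>The empty partition has no smallest part and satisfies the initial condition.\<close>

definition initial_condition :: "nat \<Rightarrow> nat list \<Rightarrow> bool" where
  "initial_condition k xs \<longleftrightarrow> (xs \<noteq> [] \<longrightarrow> (\<forall>i<k. Min (set xs) \<noteq> 2 * i + 1))"

definition cond_S :: "nat \<Rightarrow> nat list \<Rightarrow> bool" where
  "cond_S k xs \<longleftrightarrow> adjacency_condition k xs \<and> initial_condition k xs"

definition cond_C :: "nat \<Rightarrow> nat list \<Rightarrow> bool" where
  "cond_C k xs \<longleftrightarrow>
     (\<forall>m\<in>set xs. (\<exists>i<k. count_list xs m = 2 * i + 1) \<longrightarrow>
        odd (length (filter (\<lambda>x. m < x) xs)))"

text \<open>The cardinalities of sets of partitions of \<open>n\<close> are genuine counts.\<close>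

lemma finite_partitions_of: "finite (partitions_of n)"
proof -
  have "length xs \<le> sum_list xs" if "\<forall>x\<in>set xs. 0 < x" for xs :: "nat list"
    using that by (induction xs) auto
  then have "partitions_of n \<subseteq> {xs. set xs \<subseteq> {..n} \<and> length xs \<le> n}"
    using member_le_sum_list by (fastforce simp: partitions_of_def is_partition_def)
  then show ?thesis
    using finite_lists_length_le[of "{..n}" n] finite_subset by blast
qed

text \<open>The description in \<open>conjugate_partition\<close> is a proper one: the transposed Ferrers diagram
  of a partition is the diagram of exactly one partition.\<close>

lemma ferrers_inject:
  assumes "is_partition xs" "is_partition ys" "ferrers xs = ferrers ys"
  shows "xs = ys"
proof -
  have mem: "i < length xs \<and> j < xs ! i \<longleftrightarrow> i < length ys \<and> j < ys ! i" for i j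
    using assms(3) by (auto simp: ferrers_def set_eq_iff)
  have "i < length xs \<longleftrightarrow> i < length ys" for i
    using mem[of i 0] assms(1,2) nth_mem by (metis is_partition_def)
  then have len: "length xs = length ys"
    by (metis linorder_less_linear less_irrefl)
  have "xs ! i = ys ! i" if "i < length xs" for i
    using mem[of i] that len by (metis linorder_less_linear less_irrefl)
  with len show ?thesis
    by (simp add: nth_equalityI)
qed

lemma ex1_conjugate_partition:
  assumes "is_partition xs"
  shows "\<exists>!ys. is_partition ys \<and> ferrers ys = (ferrers xs)\<inverse>"
proof -
  define col where "col j = {i. i < length xs \<and> j < xs ! i}" for j
  define w where "w = (if xs = [] then 0 else xs ! 0)"
  define ys where "ys = map (\<lambda>j. card (col j)) [0..<w]"
  have anti: "xs ! i' \<le> xs ! i" if "i \<le> i'" "i' < length xs" for i i'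
    using assms that by (cases "i = i'") (auto simp: is_partition_def sorted_wrt_iff_nth_less)
  have fin: "finite (col j)" for j
    by (simp add: col_def)
  have down: "i \<in> col j" if "i' \<in> col j" "i \<le> i'" for i i' j
    using that anti[of i i'] by (auto simp: col_def)
  have col: "i \<in> col j \<longleftrightarrow> i < card (col j)" for i j
  proof
    assume "i \<in> col j"
    then have "{..i} \<subseteq> col j" using down by auto
    from card_mono[OF fin this] show "i < card (col j)" by simp
  next
    assume lt: "i < card (col j)"
    show "i \<in> col j"
    proof (rule ccontr)
      assume "i \<notin> col j"
      then have "col j \<subseteq> {..<i}" using down by (metis lessThan_iff not_le subsetI)
      from card_mono[OF _ this] lt show False by simp
    qed
  qed
  have w: "j < w" if "i \<in> col j" for i j
    using that anti[of 0 i] by (auto simp: col_def w_def)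
  have "0 \<in> col j" if "j < w" for j
    using that by (auto simp: col_def w_def split: if_splits)
  then have pos: "\<forall>y\<in>set ys. 0 < y"
    using col by (auto simp: ys_def)
  have "sorted_wrt (\<ge>) ys"
    by (auto simp: ys_def sorted_wrt_iff_nth_less col_def intro!: card_mono)
  with pos have part: "is_partition ys"
    by (simp add: is_partition_def)
  have "(j, i) \<in> ferrers ys \<longleftrightarrow> i \<in> col j" for i j
    using w[of i j] col[of i j] by (auto simp: ferrers_def ys_def)
  then have "ferrers ys = (ferrers xs)\<inverse>"
    by (auto simp: col_def ferrers_def)
  with part ferrers_inject show ?thesis
    by metis
qed

end

theory Submission
  imports Defs
begin

text \<open>
  Conjugation turns the gap between consecutive parts into the multiplicity of a part, and the
  lower of the two parts into the number of strictly greater parts. Read off a partition extended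
  by zeros, condition (S) says that a gap in \<open>{1, 3, \<dots>, 2k - 1}\<close> ends at an odd part, and this is
  condition (C) for the conjugate (\<open>adjacency_condition_append_0\<close>, \<open>cond_C_conjugate\<close>).

  To count the partitions satisfying (C), run through the parts in decreasing order and keep track
  of the parity of the number of parts seen. If it is even, the next multiplicity must be even or
  at least \<open>2k + 1\<close>; if it is odd, every multiplicity is allowed. Removing pairs of equal parts
  accounts for a factor \<open>1 / (1 - q^(2i))\<close> for each \<open>i\<close>, and leaves the parts
  \<open>i1 > i2 > i3 > \<dots>\<close> of odd multiplicity, now with multiplicities \<open>2k + 1, 1, 2k + 1, 1, \<dots>\<close>
  (\<open>weight_gf_run_partitions\<close>). So the identity reduces to the following refinement of Euler's
  theorem on distinct and odd parts, with \<open>a = 2k + 1\<close> and \<open>K = 2k + 2\<close>: the lists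
  \<open>i1 > i2 > \<dots> > 0\<close>, with weight \<open>a i1 + (K - a) i2 + a i3 + \<dots>\<close>, have the generating function
  \<open>1 / ((1 - q^a) (1 - q^(a + K)) (1 - q^(a + 2K)) \<dots>)\<close>.

  By conjugation, the lists of length \<open>r\<close> contribute the product of \<open>q^w / (1 - q^w)\<close> over the
  first \<open>r\<close> elements \<open>w\<close> of \<open>a, K, a + K, 2K, a + 2K, \<dots>\<close> (\<open>weight_gf_strict_of_length\<close>). The sum
  \<open>F(a)\<close> of these products over all \<open>r\<close> satisfies \<open>(1 - q^a) F(a) = F(a + K)\<close>; this follows just by
  grouping its terms in pairs in two ways (\<open>sum_stair_gf_shift\<close>). Since \<open>F(a + K T)\<close> tends to \<open>1\<close>
  as \<open>T\<close> grows, iteration yields the product (\<open>stair_gf_infinite_product\<close>). All limits are taken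
  as congruences modulo powers of the indeterminate.
\<close>

section \<open>Conjugation, gaps and multiplicities\<close>

text \<open>Reading a partition as an infinite sequence ending in zeros turns the fictitious zero into an
  ordinary entry, so that adjacency and the initial condition become one condition on gaps.\<close>

definition part_at :: "nat list \<Rightarrow> nat \<Rightarrow> nat" where
  "part_at xs i = (if i < length xs then xs ! i else 0)"

definition gap_cond :: "nat \<Rightarrow> nat list \<Rightarrow> bool" where
  "gap_cond k xs \<longleftrightarrow>
     (\<forall>i l. l < k \<longrightarrow> part_at xs i = part_at xs (Suc i) + (2 * l + 1) \<longrightarrow> odd (part_at xs (Suc i)))"

lemma part_at_antimono: "is_partition xs \<Longrightarrow> part_at xs (Suc i) \<le> part_at xs i"
  by (auto simp: part_at_def is_partition_def sorted_wrt_iff_nth_less)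

lemma nth_append_0: "i \<le> length xs \<Longrightarrow> (xs @ [0]) ! i = part_at xs i"
  by (simp add: part_at_def nth_append)

lemma adjacent_parts_append_0:
  "adjacent_parts (xs @ [0]) a b \<longleftrightarrow>
     (\<exists>i<length xs. {part_at xs i, part_at xs (Suc i)} = {a, b})"
  by (auto simp: adjacent_parts_def nth_append_0 doubleton_eq_iff simp del: nth_append)

text \<open>The forbidden pairs are those of an odd part lying above an even one by one of
  \<open>1, 3, \<dots>, 2 * k - 1\<close>; the opposite order cannot occur because the parts decrease.\<close>

lemma adjacency_condition_append_0:
  assumes "is_partition xs"
  shows "adjacency_condition k (xs @ [0]) \<longleftrightarrow> gap_cond k xs"
proof
  assume adj: "adjacency_condition k (xs @ [0])"
  show "gap_cond k xs"
    unfolding gap_cond_def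
  proof (intro allI impI)
    fix i l assume l: "l < k" and step: "part_at xs i = part_at xs (Suc i) + (2 * l + 1)"
    show "odd (part_at xs (Suc i))"
    proof
      assume "even (part_at xs (Suc i))"
      then obtain e where e: "part_at xs (Suc i) = 2 * e" by (rule evenE)
      have "i < length xs" using step by (auto simp: part_at_def split: if_splits)
      moreover have "{part_at xs i, part_at xs (Suc i)} = {2 * (e + l) + 1, 2 * (e + l) - 2 * l}"
        using step e by simp
      ultimately have "adjacent_parts (xs @ [0]) (2 * (e + l) + 1) (2 * (e + l) - 2 * l)"
        unfolding adjacent_parts_append_0 by blast
      then show False
        using adj l unfolding adjacency_condition_def by (metis le_add2)
    qed
  qed
next
  assume gap: "gap_cond k xs"
  show "adjacency_condition k (xs @ [0])"
    unfolding adjacency_condition_def adjacent_parts_append_0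
  proof (intro allI impI notI, elim conjE exE)
    fix j l i
    assume l: "l < k" "l \<le> j"
      and "{part_at xs i, part_at xs (Suc i)} = {2 * j + 1, 2 * j - 2 * l}"
    with part_at_antimono[OF assms, of i]
    have i: "part_at xs i = 2 * j + 1" "part_at xs (Suc i) = 2 * j - 2 * l"
      by (auto simp: doubleton_eq_iff)
    then have "part_at xs i = part_at xs (Suc i) + (2 * l + 1)"
      using l(2) by simp
    with gap l(1) have "odd (part_at xs (Suc i))"
      unfolding gap_cond_def by blast
    with i(2) show False by simp
  qed
qed

lemma Min_partition: "is_partition xs \<Longrightarrow> xs \<noteq> [] \<Longrightarrow> Min (set xs) = last xs"
proof (rule Min_eqI)
  assume xs: "is_partition xs" "xs \<noteq> []"
  show "last xs \<le> y" if "y \<in> set xs" for y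
    using xs that by (induction xs) (auto simp: is_partition_def)
qed auto

lemma adjacency_condition_append_0_iff:
  assumes "is_partition xs"
  shows "adjacency_condition k (xs @ [0]) \<longleftrightarrow> adjacency_condition k xs \<and> initial_condition k xs"
proof (cases "xs = []")
  case True
  then show ?thesis
    by (simp add: adjacency_condition_def initial_condition_def adjacent_parts_def)
next
  case False
  then obtain n where len: "length xs = Suc n"
    by (cases xs) auto
  with False have last: "last xs = xs ! n"
    by (simp add: last_conv_nth)
  have pos: "0 < last xs"
    using assms False by (simp add: is_partition_def)
  have split: "adjacent_parts (xs @ [0]) a b \<longleftrightarrow> adjacent_parts xs a b \<or> {last xs, 0} = {a, b}" for a b
  proof -
    have "adjacent_parts (xs @ [0]) a b \<longleftrightarrow>
        (\<exists>i<n. {part_at xs i, part_at xs (Suc i)} = {a, b}) \<or>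
        {part_at xs n, part_at xs (Suc n)} = {a, b}"
      unfolding adjacent_parts_append_0 len less_Suc_eq by blast
    also have "{part_at xs n, part_at xs (Suc n)} = {last xs, 0}"
      by (simp add: part_at_def len last)
    also have "(\<exists>i<n. {part_at xs i, part_at xs (Suc i)} = {a, b}) \<longleftrightarrow> adjacent_parts xs a b"
      by (auto simp: part_at_def len adjacent_parts_def doubleton_eq_iff)
    finally show ?thesis .
  qed
  have "(\<exists>j i. i < k \<and> i \<le> j \<and> {last xs, 0} = {2 * j + 1, 2 * j - 2 * i}) \<longleftrightarrow>
      (\<exists>i<k. last xs = 2 * i + 1)"
  proof
    assume "\<exists>i<k. last xs = 2 * i + 1"
    then obtain i where "i < k" "last xs = 2 * i + 1" by blast
    then show "\<exists>j i. i < k \<and> i \<le> j \<and> {last xs, 0} = {2 * j + 1, 2 * j - 2 * i}"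
      by (intro exI[of _ i]) simp
  next
    assume "\<exists>j i. i < k \<and> i \<le> j \<and> {last xs, 0} = {2 * j + 1, 2 * j - 2 * i}"
    then obtain j i where ij: "i < k" "i \<le> j" "{last xs, 0} = {2 * j + 1, 2 * j - 2 * i}"
      by blast
    from ij(3) have "last xs = 2 * j + 1" "2 * j - 2 * i = 0"
      unfolding doubleton_eq_iff by linarith+
    with ij show "\<exists>i<k. last xs = 2 * i + 1"
      by (intro exI[of _ i]) simp
  qed
  then have "\<not> (\<exists>j i. i < k \<and> i \<le> j \<and> {last xs, 0} = {2 * j + 1, 2 * j - 2 * i}) \<longleftrightarrow>
      \<not> (\<exists>i<k. last xs = 2 * i + 1)"
    by (rule arg_cong)
  then have "(\<forall>j i. i < k \<and> i \<le> j \<longrightarrow> {last xs, 0} \<noteq> {2 * j + 1, 2 * j - 2 * i}) \<longleftrightarrow>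
      initial_condition k xs"
    by (simp only: initial_condition_def Min_partition[OF assms False] False not_ex
        not_False_eq_True de_Morgan_conj imp_conv_disj simp_thms disj_assoc)
  moreover have "adjacency_condition k (xs @ [0]) \<longleftrightarrow> adjacency_condition k xs \<and>
      (\<forall>j i. i < k \<and> i \<le> j \<longrightarrow> {last xs, 0} \<noteq> {2 * j + 1, 2 * j - 2 * i})"
    unfolding adjacency_condition_def split
    by (simp only: de_Morgan_disj imp_conjR all_conj_distrib)
  ultimately show ?thesis by blast
qed

lemma
  assumes "is_partition xs"
  shows is_partition_conjugate: "is_partition (conjugate_partition xs)"
    and ferrers_conjugate: "ferrers (conjugate_partition xs) = (ferrers xs)\<inverse>"
  using theI'[OF ex1_conjugate_partition[OF assms]] by (simp_all add: conjugate_partition_def)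

lemma conjugate_conjugate:
  assumes "is_partition xs"
  shows "conjugate_partition (conjugate_partition xs) = xs"
  using assms by (intro ferrers_inject) (simp_all add: is_partition_conjugate ferrers_conjugate)

lemma card_ferrers: "card (ferrers xs) = sum_list xs"
proof -
  have "ferrers xs = (SIGMA i:{0..<length xs}. {..<xs ! i})"
    by (auto simp: ferrers_def)
  then show ?thesis by (simp add: sum_list_sum_nth)
qed

lemma sum_list_conjugate: "is_partition xs \<Longrightarrow> sum_list (conjugate_partition xs) = sum_list xs"
  by (simp flip: card_ferrers add: ferrers_conjugate)

lemma length_filter_conjugate:
  assumes "is_partition xs"
  shows "length (filter (\<lambda>y. m < y) (conjugate_partition xs)) = part_at xs m"
proof -
  let ?ys = "conjugate_partition xs"
  have "j < length ?ys \<and> m < ?ys ! j \<longleftrightarrow> m < length xs \<and> j < xs ! m" for j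
    using ferrers_conjugate[OF assms] by (auto simp: ferrers_def set_eq_iff)
  then have "{j. j < length ?ys \<and> m < ?ys ! j} = {..<part_at xs m}"
    by (auto simp: part_at_def)
  then show ?thesis by (simp add: length_filter_conv_card)
qed

text \<open>The conjugate has as many entries \<open>Suc i\<close> as there are columns of the diagram ending in row
  \<open>i\<close>: gaps of a partition are multiplicities of its conjugate.\<close>

lemma count_list_conjugate:
  assumes "is_partition xs"
  shows "part_at xs i = part_at xs (Suc i) + count_list (conjugate_partition xs) (Suc i)"
proof -
  have "length (filter (\<lambda>y. i < y) ys) = length (filter (\<lambda>y. Suc i < y) ys) + count_list ys (Suc i)" for ys
    by (induction ys) auto
  then show ?thesis using length_filter_conjugate[OF assms] by metis
qed

lemma cond_C_conjugate:
  assumes "is_partition xs"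
  shows "cond_C k (conjugate_partition xs) \<longleftrightarrow> gap_cond k xs"
proof -
  let ?ys = "conjugate_partition xs"
  have "cond_C k ?ys \<longleftrightarrow> (\<forall>m. (\<exists>l<k. count_list ?ys m = 2 * l + 1) \<longrightarrow> odd (part_at xs m))"
    unfolding cond_C_def length_filter_conjugate[OF assms]
    by (metis add_is_0 count_notin one_neq_zero)
  also have "\<dots> \<longleftrightarrow> (\<forall>i. (\<exists>l<k. count_list ?ys (Suc i) = 2 * l + 1) \<longrightarrow> odd (part_at xs (Suc i)))"
  proof -
    have "0 \<notin> set ?ys" using is_partition_conjugate[OF assms] by (auto simp: is_partition_def)
    then have "count_list ?ys 0 = 0" by simp
    then show ?thesis by (metis add_is_0 one_neq_zero not0_implies_Suc)
  qed
  also have "\<dots> \<longleftrightarrow> gap_cond k xs"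
    unfolding gap_cond_def using count_list_conjugate[OF assms] by (metis add_left_cancel)
  finally show ?thesis .
qed

lemma cond_S_iff_cond_C:
  "is_partition xs \<Longrightarrow> cond_S k xs \<longleftrightarrow> cond_C k (conjugate_partition xs)"
  using adjacency_condition_append_0_iff adjacency_condition_append_0 cond_C_conjugate cond_S_def
  by blast

lemma card_cond_S_eq_cond_C:
  "card {xs \<in> partitions_of n. cond_S k xs} = card {xs \<in> partitions_of n. cond_C k xs}"
proof (rule bij_betw_same_card[OF bij_betw_byWitness])
  show "conjugate_partition ` {xs \<in> partitions_of n. cond_S k xs} \<subseteq> {xs \<in> partitions_of n. cond_C k xs}"
    by (auto simp: partitions_of_def is_partition_conjugate sum_list_conjugate cond_S_iff_cond_C)
  show "conjugate_partition ` {xs \<in> partitions_of n. cond_C k xs} \<subseteq> {xs \<in> partitions_of n. cond_S k xs}"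
    by (auto simp: partitions_of_def is_partition_conjugate sum_list_conjugate cond_S_iff_cond_C
        conjugate_conjugate)
qed (auto simp: partitions_of_def conjugate_conjugate)

section \<open>Generating functions of weighted sets\<close>

definition weight_gf :: "('a \<Rightarrow> nat) \<Rightarrow> 'a set \<Rightarrow> rat fps" where
  "weight_gf wt A = Abs_fps (\<lambda>n. of_nat (card {x \<in> A. wt x = n}))"

lemma weight_gf_nth: "fps_nth (weight_gf wt A) n = of_nat (card {x \<in> A. wt x = n})"
  by (simp add: weight_gf_def)

lemma weight_gf_Un:
  assumes "\<And>n. finite {x \<in> A. wt x = n}" "\<And>n. finite {x \<in> B. wt x = n}" "A \<inter> B = {}"
  shows "weight_gf wt (A \<union> B) = weight_gf wt A + weight_gf wt B"
proof (rule fps_ext)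
  fix n
  have "{x \<in> A \<union> B. wt x = n} = {x \<in> A. wt x = n} \<union> {x \<in> B. wt x = n}"
    by auto
  then show "fps_nth (weight_gf wt (A \<union> B)) n = fps_nth (weight_gf wt A + weight_gf wt B) n"
    using assms by (simp add: weight_gf_nth card_Un_disjoint disjoint_iff)
qed

lemma weight_gf_image:
  assumes "inj_on f A" "\<And>x. x \<in> A \<Longrightarrow> wt' (f x) = c + wt x"
  shows "weight_gf wt' (f ` A) = fps_X ^ c * weight_gf wt A"
proof (rule fps_ext)
  fix n
  have eq: "{y \<in> f ` A. wt' y = n} = f ` {x \<in> A. c + wt x = n}"
    using assms(2) by auto
  have "card {y \<in> f ` A. wt' y = n} = card {x \<in> A. c + wt x = n}"
    unfolding eq by (rule card_image) (use assms(1) in \<open>auto intro: inj_on_subset\<close>)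
  also have "{x \<in> A. c + wt x = n} = (if n < c then {} else {x \<in> A. wt x = n - c})"
    by auto
  finally show "fps_nth (weight_gf wt' (f ` A)) n = fps_nth (fps_X ^ c * weight_gf wt A) n"
    by (simp add: weight_gf_nth fps_X_power_mult_nth)
qed

lemma weight_gf_singleton: "weight_gf wt {x} = fps_X ^ wt x"
proof (rule fps_ext)
  fix n
  have "{y \<in> {x}. wt y = n} = (if n = wt x then {x} else {})" by auto
  then show "fps_nth (weight_gf wt {x}) n = fps_nth (fps_X ^ wt x) n"
    by (simp add: weight_gf_nth)
qed

lemma one_minus_fps_X_power_inverse:
  "0 < m \<Longrightarrow> (1 - fps_X ^ m) * inverse (1 - fps_X ^ m :: rat fps) = 1"
  by (rule inverse_mult_eq_1') simp

text \<open>The equation \<open>f = g + X ^ m * f\<close> arises when a set splits into a simpler part and a copy of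
  itself with all weights raised by \<open>m\<close>.\<close>

lemma eq_geometric_inverse:
  fixes f g :: "rat fps"
  assumes "0 < m" "f = g + fps_X ^ m * f"
  shows "f = inverse (1 - fps_X ^ m) * g"
proof -
  have "f - fps_X ^ m * f = g"
    using assms(2) by (simp add: diff_eq_eq)
  then have "g = (1 - fps_X ^ m) * f"
    by (simp add: left_diff_distrib)
  then have "inverse (1 - fps_X ^ m) * g = ((1 - fps_X ^ m) * inverse (1 - fps_X ^ m)) * f"
    by (simp only: mult_ac)
  then show ?thesis
    by (simp only: one_minus_fps_X_power_inverse[OF assms(1)] mult_1)
qed

definition partitions_into :: "nat set \<Rightarrow> nat list set" where
  "partitions_into A = {xs. is_partition xs \<and> set xs \<subseteq> A}"

lemma finite_partition_level:
  assumes "\<And>xs. xs \<in> A \<Longrightarrow> is_partition xs"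
  shows "finite {xs \<in> A. sum_list xs = n}"
  by (rule finite_subset[OF _ finite_partitions_of[of n]]) (use assms in \<open>auto simp: partitions_of_def\<close>)

lemma is_partition_Cons:
  "is_partition (x # xs) \<longleftrightarrow> 0 < x \<and> (\<forall>y\<in>set xs. y \<le> x) \<and> is_partition xs"
  by (auto simp: is_partition_def)

lemma weight_gf_partitions_into:
  assumes "finite A" "0 \<notin> A"
  shows "weight_gf sum_list (partitions_into A) = (\<Prod>m\<in>A. inverse (1 - fps_X ^ m))"
  using assms
proof (induction A rule: finite_linorder_max_induct)
  case empty
  have "partitions_into {} = {[]}" by (auto simp: partitions_into_def is_partition_def)
  then show ?case by (simp add: weight_gf_singleton)
next
  case (insert b A)
  let ?P = "partitions_into A" and ?Q = "partitions_into (insert b A)"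
  have b: "0 < b" "b \<notin> A" using insert by auto
  have eq: "?Q = ?P \<union> (#) b ` ?Q"
  proof (intro equalityI subsetI)
    fix xs assume xs: "xs \<in> ?Q"
    show "xs \<in> ?P \<union> (#) b ` ?Q"
    proof (cases "b \<in> set xs")
      case False
      then show ?thesis using xs by (auto simp: partitions_into_def)
    next
      case True
      then obtain y ys where ys: "xs = y # ys" by (cases xs) auto
      have "b \<le> y" "y \<in> insert b A"
        using xs True by (auto simp: ys partitions_into_def is_partition_Cons)
      then have "y = b" using insert.hyps(2) by fastforce
      then show ?thesis using xs by (auto simp: ys partitions_into_def is_partition_Cons)
    qed
  next
    fix xs assume "xs \<in> ?P \<union> (#) b ` ?Q"
    then show "xs \<in> ?Q"
      using b insert.hyps(2) by (fastforce simp: partitions_into_def is_partition_Cons)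
  qed
  have "weight_gf sum_list ?Q = weight_gf sum_list (?P \<union> (#) b ` ?Q)"
    by (rule arg_cong[OF eq])
  moreover have "weight_gf sum_list (?P \<union> (#) b ` ?Q)
      = weight_gf sum_list ?P + weight_gf sum_list ((#) b ` ?Q)"
  proof (rule weight_gf_Un)
    show "finite {xs \<in> (#) b ` ?Q. sum_list xs = n}" for n
      using eq by (intro finite_partition_level) (auto simp: partitions_into_def)
    show "finite {xs \<in> ?P. sum_list xs = n}" for n
      by (intro finite_partition_level) (simp add: partitions_into_def)
    show "?P \<inter> (#) b ` ?Q = {}"
      using b by (auto simp: partitions_into_def)
  qed
  moreover have "weight_gf sum_list ((#) b ` ?Q) = fps_X ^ b * weight_gf sum_list ?Q"
    by (rule weight_gf_image) auto
  ultimately have "weight_gf sum_list ?Q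
      = weight_gf sum_list ?P + fps_X ^ b * weight_gf sum_list ?Q"
    by simp
  from eq_geometric_inverse[OF b(1) this] show ?case
    using insert b by simp
qed

section \<open>Strict lists with alternating weights\<close>

fun alt_sum :: "nat \<Rightarrow> nat \<Rightarrow> nat list \<Rightarrow> nat" where
  "alt_sum a b [] = 0"
| "alt_sum a b (x # xs) = a * x + alt_sum b a xs"

text \<open>For lists of length \<open>r\<close> this is the growth of \<open>alt_sum a b\<close>, with \<open>K = a + b\<close>, when every
  entry grows by one. In terms of \<open>K\<close> it stays meaningful when \<open>a\<close> exceeds \<open>K\<close>, where \<open>b\<close> would
  be negative; the shift \<open>a \<mapsto> a + K\<close> in the functional equation below needs this.\<close>

definition level :: "nat \<Rightarrow> nat \<Rightarrow> nat \<Rightarrow> nat" where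
  "level a K r = K * (r div 2) + a * (r mod 2)"

lemma level_Suc: "level a (a + b) (Suc r) = a + level b (b + a) r"
proof (cases "even r")
  case True
  then obtain s where "r = 2 * s" by (rule evenE)
  then show ?thesis by (simp add: level_def)
next
  case False
  then obtain s where "r = 2 * s + 1" by (rule oddE)
  then show ?thesis by (simp add: level_def)
qed

lemma level_ge: "r \<le> level a K r" if "0 < a" "2 \<le> K"
proof -
  have "r = 2 * (r div 2) + 1 * (r mod 2)" by simp
  also have "\<dots> \<le> level a K r"
    unfolding level_def using that by (intro add_mono mult_right_mono) auto
  finally show ?thesis .
qed

lemma alt_sum_map_Suc: "alt_sum a b (map Suc xs) = level a (a + b) (length xs) + alt_sum a b xs"
  by (induction xs arbitrary: a b) (simp_all add: level_Suc, simp add: level_def)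

lemma alt_sum_append_0: "alt_sum a b (xs @ [0]) = alt_sum a b xs"
  by (induction xs arbitrary: a b) auto

lemma alt_sum_ge:
  assumes "0 < a" "0 < b" shows "sum_list xs \<le> alt_sum a b xs"
  using assms
proof (induction xs arbitrary: a b)
  case (Cons x xs)
  from Cons.IH[of b a] Cons.prems have "sum_list xs \<le> alt_sum b a xs" by simp
  moreover have "x \<le> a * x" using Cons.prems by simp
  ultimately show ?case by (simp only: alt_sum.simps sum_list.Cons add_mono)
qed simp

definition strict_of_length :: "nat \<Rightarrow> nat list set" where
  "strict_of_length r = {xs. sorted_wrt (>) xs \<and> 0 \<notin> set xs \<and> length xs = r}"

lemma finite_alt_sum_level:
  assumes "0 < a" "0 < b"
  shows "finite {xs. length xs = r \<and> alt_sum a b xs = n}"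
proof (rule finite_subset)
  show "{xs. length xs = r \<and> alt_sum a b xs = n} \<subseteq> {xs. set xs \<subseteq> {..n} \<and> length xs = r}"
    using alt_sum_ge[OF assms] by (auto dest: member_le_sum_list intro: order_trans)
  show "finite {xs :: nat list. set xs \<subseteq> {..n} \<and> length xs = r}"
    by (rule finite_lists_length_eq) simp
qed

text \<open>Conjugates of strict lists of length \<open>r\<close> are the partitions whose set of parts is
  \<open>{1, \<dots>, r}\<close>; under alternating weights a part \<open>j\<close> of the conjugate weighs \<open>level a K j\<close> and
  occurs at least once, which gives one factor \<open>q^w / (1 - q^w)\<close> for each \<open>j\<close>.\<close>

primrec stair_gf :: "nat \<Rightarrow> nat \<Rightarrow> nat \<Rightarrow> rat fps" where
  "stair_gf a K 0 = 1"
| "stair_gf a K (Suc r) =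
     fps_X ^ level a K (Suc r) * inverse (1 - fps_X ^ level a K (Suc r)) * stair_gf a K r"

lemma sorted_wrt_gt_map_Suc: "sorted_wrt (>) (map Suc xs) \<longleftrightarrow> sorted_wrt (>) xs"
  by (induction xs) auto

text \<open>Lowering all entries by one leaves a strict list of positive numbers, or one with a single
  final zero, which carries no weight. Iterated, this is conjugation read column by column.\<close>

lemma strict_of_length_Suc:
  "strict_of_length (Suc r) =
     map Suc ` (strict_of_length (Suc r) \<union> (\<lambda>xs. xs @ [0]) ` strict_of_length r)"
proof (intro equalityI subsetI)
  fix xs assume xs: "xs \<in> strict_of_length (Suc r)"
  define ys where "ys = map (\<lambda>x. x - 1) xs"
  have xs_eq: "xs = map Suc ys"
  proof (rule nth_equalityI)
    fix i assume i: "i < length xs"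
    then have "xs ! i \<noteq> 0"
      using xs nth_mem[OF i] by (metis (mono_tags, lifting) mem_Collect_eq strict_of_length_def)
    with i show "xs ! i = map Suc ys ! i" by (simp add: ys_def)
  qed (simp add: ys_def)
  have ys: "sorted_wrt (>) ys" "length ys = Suc r"
    using xs[unfolded xs_eq] by (simp_all add: strict_of_length_def sorted_wrt_gt_map_Suc)
  have "ys \<in> strict_of_length (Suc r) \<union> (\<lambda>xs. xs @ [0]) ` strict_of_length r"
  proof (cases "0 \<in> set ys")
    case False
    then show ?thesis using ys by (simp add: strict_of_length_def)
  next
    case True
    obtain zs z where zs: "ys = zs @ [z]" "length zs = r"
      using ys(2) by (auto simp: length_Suc_conv_rev)
    from ys(1) have "sorted_wrt (>) zs" and gt: "\<forall>x\<in>set zs. z < x"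
      by (simp_all add: zs(1) sorted_wrt_append)
    moreover have "z = 0" "0 \<notin> set zs"
      using True gt by (auto simp: zs(1))
    ultimately show ?thesis using zs by (simp add: strict_of_length_def)
  qed
  then show "xs \<in> map Suc ` (strict_of_length (Suc r) \<union> (\<lambda>xs. xs @ [0]) ` strict_of_length r)"
    unfolding xs_eq by (rule imageI)
next
  fix xs assume "xs \<in> map Suc ` (strict_of_length (Suc r) \<union> (\<lambda>xs. xs @ [0]) ` strict_of_length r)"
  then show "xs \<in> strict_of_length (Suc r)"
    by (auto simp: strict_of_length_def sorted_wrt_append sorted_wrt_gt_map_Suc intro!: gr0I)
qed

lemma weight_gf_strict_of_length:
  assumes "0 < a" "0 < b"
  shows "weight_gf (alt_sum a b) (strict_of_length r) = stair_gf a (a + b) r"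
proof (induction r)
  case 0
  have "strict_of_length 0 = {[]}" by (auto simp: strict_of_length_def)
  then show ?case by (simp add: weight_gf_singleton)
next
  case (Suc r)
  let ?f = "\<lambda>r. weight_gf (alt_sum a b) (strict_of_length r)"
  let ?B = "(\<lambda>xs. xs @ [0]) ` strict_of_length r"
  let ?l = "level a (a + b) (Suc r)"
  have l: "0 < ?l" using level_ge[of a "a + b" "Suc r"] assms by simp
  have fin: "finite {x \<in> A. alt_sum a b x = n}" if "\<forall>x\<in>A. length x = Suc r" for A n
    by (rule finite_subset[OF _ finite_alt_sum_level[OF assms, of "Suc r" n]]) (use that in auto)
  have "?f (Suc r) = weight_gf (alt_sum a b) (map Suc ` (strict_of_length (Suc r) \<union> ?B))"
    using strict_of_length_Suc[of r] by simp
  moreover have "weight_gf (alt_sum a b) (map Suc ` (strict_of_length (Suc r) \<union> ?B))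
      = fps_X ^ ?l * weight_gf (alt_sum a b) (strict_of_length (Suc r) \<union> ?B)"
  proof (rule weight_gf_image)
    show "inj_on (map Suc) (strict_of_length (Suc r) \<union> ?B)"
      by (rule inj_on_subset[OF inj_mapI]) simp_all
    show "alt_sum a b (map Suc xs) = ?l + alt_sum a b xs"
      if "xs \<in> strict_of_length (Suc r) \<union> ?B" for xs
    proof -
      have "length xs = Suc r"
        using that by (auto simp: strict_of_length_def)
      then show ?thesis by (simp only: alt_sum_map_Suc)
    qed
  qed
  moreover have "weight_gf (alt_sum a b) (strict_of_length (Suc r) \<union> ?B)
      = ?f (Suc r) + weight_gf (alt_sum a b) ?B"
  proof (rule weight_gf_Un)
    show "strict_of_length (Suc r) \<inter> ?B = {}"
      by (auto simp: strict_of_length_def)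
  qed (rule fin, auto simp: strict_of_length_def)+
  moreover have "weight_gf (alt_sum a b) ?B = fps_X ^ 0 * ?f r"
    by (rule weight_gf_image) (auto simp: alt_sum_append_0 inj_on_def)
  ultimately have "?f (Suc r) = fps_X ^ ?l * ?f r + fps_X ^ ?l * ?f (Suc r)"
    by (simp only: power_0 mult_1 distrib_left add.commute)
  from eq_geometric_inverse[OF l this] show ?case
    by (simp only: Suc.IH stair_gf.simps mult_ac)
qed

section \<open>The functional equation and the product\<close>

lemma level_even: "level a K (2 * s) = K * s"
  and level_odd: "level a K (Suc (2 * s)) = K * s + a"
  by (simp_all add: level_def)

lemma stair_gf_odd: "stair_gf a K (Suc (2 * s)) =
    fps_X ^ (K * s + a) * inverse (1 - fps_X ^ (K * s + a)) * stair_gf a K (2 * s)"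
  by (simp only: stair_gf.simps level_odd)

lemma stair_gf_even: "stair_gf a K (Suc (Suc (2 * s))) =
    fps_X ^ (K * Suc s) * inverse (1 - fps_X ^ (K * Suc s)) * stair_gf a K (Suc (2 * s))"
  using level_even[of a K "Suc s"]
  by (simp only: stair_gf.simps(2)[of _ _ "Suc (2 * s)"] mult_Suc_right[of 2] add_2_eq_Suc)

lemma stair_gf_shift_even:
  assumes "0 < a"
  shows "stair_gf (a + K) K (2 * s) =
    (1 - fps_X ^ a) * fps_X ^ (K * s) * inverse (1 - fps_X ^ (K * s + a)) * stair_gf a K (2 * s)"
proof (induction s)
  case 0
  then show ?case using one_minus_fps_X_power_inverse[OF assms] by simp
next
  case (Suc s)
  have s: "K * s + (a + K) = K * Suc s + a"
    by simp
  define u v w :: "rat fps" where "u = inverse (1 - fps_X ^ (K * s + a))"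
    and "v = inverse (1 - fps_X ^ (K * Suc s))" and "w = inverse (1 - fps_X ^ (K * Suc s + a))"
  define p where "p = stair_gf a K (2 * s)"
  have *: "fps_X ^ (K * s) * fps_X ^ (K * Suc s + a) =
      (fps_X ^ (K * Suc s) * fps_X ^ (K * s + a) :: rat fps)"
    by (simp flip: power_add add: ac_simps)
  have "stair_gf (a + K) K (Suc (Suc (2 * s))) =
      (1 - fps_X ^ a) * fps_X ^ (K * Suc s) * u * v * w * p *
      (fps_X ^ (K * s) * fps_X ^ (K * Suc s + a))"
    unfolding stair_gf_even stair_gf_odd s Suc.IH u_def v_def w_def p_def
    by (simp only: mult_ac)
  also have "\<dots> = (1 - fps_X ^ a) * fps_X ^ (K * Suc s) * w * stair_gf a K (Suc (Suc (2 * s)))"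
    unfolding * stair_gf_even stair_gf_odd u_def[symmetric] v_def[symmetric] p_def[symmetric]
    by (simp only: mult_ac)
  finally show ?case
    by (simp only: w_def mult_Suc_right[of 2] add_2_eq_Suc)
qed

text \<open>Put \<open>x = X ^ a\<close> and \<open>Q = X ^ K\<close>. The functional equation \<open>(1 - x) F(x) = F(x Q)\<close>, which is the
  one satisfied by \<open>1 / ((1 - x) (1 - x Q) (1 - x Q\<^sup>2) \<dots>)\<close>, holds exactly already for the partial
  sums: only the grouping into pairs differs, as the terms \<open>2 s - 1\<close> and \<open>2 s\<close> for \<open>x Q\<close> together
  are \<open>1 - x\<close> times the terms \<open>2 s\<close> and \<open>2 s + 1\<close> for \<open>x\<close>.\<close>

lemma sum_stair_gf_shift:
  assumes "0 < a" "0 < K"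
  shows "(\<Sum>r\<le>2 * N. stair_gf (a + K) K r) = (1 - fps_X ^ a) * (\<Sum>r\<le>Suc (2 * N). stair_gf a K r)"
proof (induction N)
  case 0
  define u where "u = inverse (1 - fps_X ^ a :: rat fps)"
  have u: "(1 - fps_X ^ a) * u = 1"
    using one_minus_fps_X_power_inverse[OF assms(1)] by (simp add: u_def)
  then have "1 + fps_X ^ a * u = u"
    by (simp add: left_diff_distrib diff_eq_eq)
  with u have "(1 - fps_X ^ a) * (1 + fps_X ^ a * u) = 1"
    by simp
  then show ?case by (simp add: level_def u_def)
next
  case (Suc N)
  define x Q R :: "rat fps" where "x = fps_X ^ a" and "Q = fps_X ^ (K * N)" and "R = fps_X ^ K"
  define u v w where "u = inverse (1 - x * Q)" and "v = inverse (1 - Q * R)"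
    and "w = inverse (1 - x * Q * R)"
  have v: "(1 - Q * R) * v = 1" and w: "(1 - x * Q * R) * w = 1"
    using one_minus_fps_X_power_inverse[of "K * Suc N"] one_minus_fps_X_power_inverse[of "K * Suc N + a"] assms
    by (simp_all add: u_def v_def w_def Q_def x_def R_def power_add mult_ac)
  let ?g = "stair_gf (a + K) K" and ?f = "stair_gf a K"
  define p where "p = ?f (2 * N)"
  have odd: "stair_gf c K (Suc (2 * N)) =
      fps_X ^ c * Q * inverse (1 - fps_X ^ c * Q) * stair_gf c K (2 * N)" for c
    unfolding stair_gf_odd Q_def by (simp only: power_add mult_ac)
  have even: "stair_gf c K (Suc (Suc (2 * N))) = Q * R * v * stair_gf c K (Suc (2 * N))" for c
    unfolding stair_gf_even Q_def R_def v_def by (simp only: power_add mult_Suc_right mult_ac)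
  have odd': "?f (Suc (Suc (Suc (2 * N)))) = x * Q * R * w * ?f (Suc (Suc (2 * N)))"
    using stair_gf_odd[of a K "Suc N", unfolded mult_Suc_right[of 2] add_2_eq_Suc]
    by (simp only: x_def Q_def R_def w_def power_add mult_Suc_right mult_ac)
  have x': "fps_X ^ (a + K) * Q = x * Q * R"
    by (simp add: x_def R_def power_add mult_ac)
  have f1: "?f (Suc (2 * N)) = x * Q * u * p"
    unfolding odd by (simp only: x_def u_def p_def)
  have f2: "?f (Suc (Suc (2 * N))) = Q * R * v * (x * Q * u * p)"
    unfolding even f1 ..
  have f3: "?f (Suc (Suc (Suc (2 * N)))) = x * Q * R * w * (Q * R * v * (x * Q * u * p))"
    unfolding odd' f2 ..
  have g0: "?g (2 * N) = (1 - x) * Q * u * p"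
    using stair_gf_shift_even[OF assms(1), of K N]
    by (simp only: x_def Q_def u_def p_def power_add mult_ac)
  have g1: "?g (Suc (2 * N)) = x * Q * R * w * ((1 - x) * Q * u * p)"
    unfolding odd x' g0 w_def ..
  have g2: "?g (Suc (Suc (2 * N))) = Q * R * v * (x * Q * R * w * ((1 - x) * Q * u * p))"
    unfolding even g1 ..
  have "?g (Suc (2 * N)) + ?g (Suc (Suc (2 * N)))
      = (1 - x) * (?f (Suc (Suc (2 * N))) + ?f (Suc (Suc (Suc (2 * N)))))"
  proof -
    \<comment> \<open>Both pairs share the factor \<open>x * Q\<^sup>2 * R * u * v * w * p\<close>, since
      \<open>1 + y / (1 - y) = 1 / (1 - y)\<close>.\<close>
    have "1 + Q * R * v = v" and "1 + x * Q * R * w = w"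
      using v w by (simp_all add: left_diff_distrib diff_eq_eq)
    moreover have "?g (Suc (2 * N)) + ?g (Suc (Suc (2 * N))) =
        (1 - x) * x * Q * Q * R * u * w * p * (1 + Q * R * v)"
      unfolding g1 g2 by (simp add: distrib_left mult_ac)
    moreover have "?f (Suc (Suc (2 * N))) + ?f (Suc (Suc (Suc (2 * N)))) =
        x * Q * Q * R * u * v * p * (1 + x * Q * R * w)"
      unfolding f2 f3 by (simp add: distrib_left mult_ac)
    ultimately show ?thesis by (simp add: mult_ac)
  qed
  then show ?case using Suc.IH by (simp add: x_def algebra_simps)
qed

lemma fps_X_power_dvd_iff: "fps_X ^ n dvd f \<longleftrightarrow> (\<forall>i<n. fps_nth f i = 0)" for f :: "rat fps"
proof
  assume "\<forall>i<n. fps_nth f i = 0"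
  then have "f = fps_X ^ n * fps_shift n f"
    by (intro fps_ext) (simp add: fps_X_power_mult_nth)
  then show "fps_X ^ n dvd f" by (rule dvdI)
qed (auto simp: fps_X_power_mult_nth)

lemma X_power_dvd_stair_gf:
  assumes "0 < a" "2 \<le> K"
  shows "fps_X ^ r dvd stair_gf a K r"
proof (induction r)
  case (Suc r)
  have "fps_X ^ 1 dvd (fps_X ^ level a K (Suc r) :: rat fps)"
    by (rule le_imp_power_dvd) (use level_ge[OF assms, of "Suc r"] in simp)
  then have "fps_X ^ 1 * fps_X ^ r dvd
      (fps_X ^ level a K (Suc r) * inverse (1 - fps_X ^ level a K (Suc r)) * stair_gf a K r :: rat fps)"
    using Suc.IH by (intro mult_dvd_mono dvd_mult2)
  then show ?case by (simp only: stair_gf.simps power_one_right power_Suc)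
qed simp

lemma X_power_dvd_stair_gf_start: "fps_X ^ a dvd stair_gf a K (Suc r)"
proof (induction r)
  case 0
  show ?case by (simp add: level_def mult.assoc)
next
  case (Suc r)
  show ?case
    by (subst stair_gf.simps(2)) (rule dvd_mult[OF Suc.IH])
qed

text \<open>Each application of the functional equation contributes one factor; passing from \<open>2 * N + 1\<close>
  back to \<open>2 * N\<close> costs one term of high order.\<close>

lemma stair_gf_product:
  assumes "0 < a" "2 \<le> K" "n \<le> 2 * N + 1"
  shows "fps_X ^ n dvd
    (\<Prod>t<T. 1 - fps_X ^ (a + K * t)) * (\<Sum>r\<le>2 * N. stair_gf a K r)
    - (\<Sum>r\<le>2 * N. stair_gf (a + K * T) K r)"
  using assms(1)
proof (induction T arbitrary: a)
  case (Suc T)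
  let ?S = "\<lambda>a. \<Sum>r\<le>2 * N. stair_gf a K r"
  define Q :: "rat fps" where "Q = (\<Prod>t<T. 1 - fps_X ^ ((a + K) + K * t))"
  have P: "(\<Prod>t<Suc T. 1 - fps_X ^ (a + K * t)) = (1 - fps_X ^ a) * Q"
    unfolding Q_def prod.lessThan_Suc_shift by (simp add: add.assoc)
  have "?S (a + K) = (1 - fps_X ^ a) * (?S a + stair_gf a K (Suc (2 * N)))"
    using sum_stair_gf_shift[of a K N] Suc.prems assms(2) by (simp only: sum.atMost_Suc)
  then have "(\<Prod>t<Suc T. 1 - fps_X ^ (a + K * t)) * ?S a - ?S (a + K * Suc T)
      = (Q * ?S (a + K) - ?S ((a + K) + K * T)) - (1 - fps_X ^ a) * Q * stair_gf a K (Suc (2 * N))"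
    unfolding P by (simp only: mult_Suc_right add.assoc distrib_left) (simp add: mult_ac)
  moreover have "fps_X ^ n dvd Q * ?S (a + K) - ?S ((a + K) + K * T)"
    unfolding Q_def by (rule Suc.IH) (use Suc.prems in simp)
  moreover have "fps_X ^ n dvd stair_gf a K (Suc (2 * N))"
    using le_imp_power_dvd X_power_dvd_stair_gf[OF Suc.prems assms(2)]
    by (rule dvd_trans) (use assms(3) in simp)
  ultimately show ?case
    by (simp only: dvd_diff dvd_mult)
qed simp

text \<open>Once the functional equation has raised \<open>a\<close> to at least \<open>n\<close>, every term except the initial
  \<open>1\<close> vanishes modulo \<open>X ^ n\<close>.\<close>

lemma stair_gf_infinite_product:
  assumes "0 < a" "2 \<le> K" "n \<le> 2 * N + 1" "n \<le> T"
  shows "fps_X ^ n dvd (\<Prod>t<T. 1 - fps_X ^ (a + K * t)) * (\<Sum>r\<le>2 * N. stair_gf a K r) - 1"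
proof -
  let ?S = "\<lambda>a. \<Sum>r\<le>2 * N. stair_gf a K r"
  let ?a = "a + K * T"
  have "1 * T \<le> K * T" by (rule mult_right_mono) (use assms(2) in auto)
  then have "n \<le> ?a" using assms(4) by linarith
  have "fps_X ^ n dvd stair_gf ?a K (Suc r)" for r
    using X_power_dvd_stair_gf_start[of ?a K r] le_imp_power_dvd[OF \<open>n \<le> ?a\<close>] by (rule dvd_trans[rotated])
  then have "fps_X ^ n dvd (\<Sum>r<2 * N. stair_gf ?a K (Suc r))"
    by (intro dvd_sum)
  moreover have "?S ?a - 1 = (\<Sum>r<2 * N. stair_gf ?a K (Suc r))"
    by (simp add: lessThan_Suc_atMost[symmetric] sum.lessThan_Suc_shift del: stair_gf.simps(2) sum.lessThan_Suc)
  ultimately have "fps_X ^ n dvd ?S ?a - 1" by metis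
  with stair_gf_product[OF assms(1-3), of T]
  have "fps_X ^ n dvd ((\<Prod>t<T. 1 - fps_X ^ (a + K * t)) * ?S a - ?S ?a) + (?S ?a - 1)"
    by (rule dvd_add)
  then show ?thesis by simp
qed

section \<open>Multiplicities governed by parity\<close>

text \<open>Condition (C) for a partition that continues one with \<open>p\<close> larger parts. Removing the largest
  parts of a partition leads to this form; only the parity of \<open>p\<close> matters.\<close>

definition run_cond :: "nat \<Rightarrow> nat \<Rightarrow> nat list \<Rightarrow> bool" where
  "run_cond k p xs \<longleftrightarrow>
     (\<forall>m\<in>set xs. (\<exists>i<k. count_list xs m = 2 * i + 1) \<longrightarrow>
        odd (p + length (filter (\<lambda>x. m < x) xs)))"

definition run_partitions :: "nat \<Rightarrow> nat \<Rightarrow> nat \<Rightarrow> nat list set" where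
  "run_partitions k p L = {xs \<in> partitions_into {..L}. run_cond k p xs}"

text \<open>The smallest odd multiplicity permitted to a part with \<open>p\<close> greater parts; even
  multiplicities, and all larger odd ones, are always permitted.\<close>

definition min_odd_run :: "nat \<Rightarrow> nat \<Rightarrow> nat" where
  "min_odd_run k p = (if odd p then 1 else 2 * k + 1)"

lemma run_partitions_cong: "even p = even p' \<Longrightarrow> run_partitions k p L = run_partitions k p' L"
  by (simp add: run_partitions_def run_cond_def)

lemma small_odd_iff: "(\<exists>i<k. c = 2 * i + 1) \<longleftrightarrow> odd c \<and> c < min_odd_run k 0"
  by (auto simp: min_odd_run_def elim!: oddE)

lemma partition_split_max:
  assumes "xs \<in> partitions_into {..Suc L}"
  obtains c ys where "xs = replicate c (Suc L) @ ys" "ys \<in> partitions_into {..L}"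
proof -
  have "\<exists>c ys. xs = replicate c (Suc L) @ ys \<and> ys \<in> partitions_into {..L}"
    using assms
  proof (induction xs)
    case Nil
    then show ?case by (auto simp: partitions_into_def is_partition_def)
  next
    case (Cons x xs)
    show ?case
    proof (cases "x = Suc L")
      case True
      from Cons obtain c ys where "xs = replicate c (Suc L) @ ys" "ys \<in> partitions_into {..L}"
        by (auto simp: partitions_into_def is_partition_Cons)
      then show ?thesis using True by (intro exI[of _ "Suc c"] exI[of _ ys]) simp
    next
      case False
      then have "x # xs \<in> partitions_into {..L}"
        using Cons.prems by (fastforce simp: partitions_into_def is_partition_Cons)
      then show ?thesis by (intro exI[of _ 0] exI[of _ "x # xs"]) simp
    qed
  qed
  then show thesis using that by blast
qed

lemma run_partitions_replicate:
  assumes "ys \<in> partitions_into {..L}"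
  shows "replicate c (Suc L) @ ys \<in> run_partitions k p (Suc L) \<longleftrightarrow>
     ys \<in> run_partitions k (p + c) L \<and> (odd c \<longrightarrow> min_odd_run k p \<le> c)"
proof -
  have le: "y \<le> L" if "y \<in> set ys" for y
    using assms that by (auto simp: partitions_into_def)
  then have less: "y < Suc L" if "y \<in> set ys" for y
    using that by (simp add: less_Suc_eq_le)
  then have M: "Suc L \<notin> set ys"
    by blast
  have part: "replicate c (Suc L) @ ys \<in> partitions_into {..Suc L}"
    by (induction c) (use assms less in \<open>auto simp: partitions_into_def is_partition_Cons less_imp_le\<close>)
  have count_rep: "count_list (replicate c x) m = (if m = x then c else 0)" for x m :: nat
    by (induction c) auto
  define zs where "zs = replicate c (Suc L) @ ys"
  have set_zs: "set zs = set ys \<union> (if c = 0 then {} else {Suc L})"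
    by (simp add: zs_def)
  have count: "count_list zs (Suc L) = c" "m \<in> set ys \<Longrightarrow> count_list zs m = count_list ys m" for m
    using M by (auto simp: zs_def count_list_0_iff count_rep)
  have greater: "filter ((<) (Suc L)) zs = []"
    "m \<in> set ys \<Longrightarrow> length (filter ((<) m) zs) = c + length (filter ((<) m) ys)" for m
    using less by (fastforce simp: zs_def filter_empty_conv)+
  have "run_cond k p zs \<longleftrightarrow>
     (\<forall>m\<in>set ys. (\<exists>i<k. count_list zs m = 2 * i + 1) \<longrightarrow> odd (p + length (filter ((<) m) zs))) \<and>
     (0 < c \<longrightarrow> (\<exists>i<k. count_list zs (Suc L) = 2 * i + 1) \<longrightarrow>
       odd (p + length (filter ((<) (Suc L)) zs)))"
    unfolding run_cond_def set_zs by (cases "c = 0") (simp_all add: ball_Un conj_commute)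
  also have "(\<forall>m\<in>set ys. (\<exists>i<k. count_list zs m = 2 * i + 1) \<longrightarrow> odd (p + length (filter ((<) m) zs)))
      \<longleftrightarrow> run_cond k (p + c) ys"
    unfolding run_cond_def by (rule ball_cong) (simp_all only: count greater add.assoc)
  also have "((\<exists>i<k. count_list zs (Suc L) = 2 * i + 1) \<longrightarrow>
       odd (p + length (filter ((<) (Suc L)) zs))) \<longleftrightarrow> (odd c \<and> c < min_odd_run k 0 \<longrightarrow> odd p)"
    by (simp only: count greater small_odd_iff list.size add_0_right)
  also have "(0 < c \<longrightarrow> odd c \<and> c < min_odd_run k 0 \<longrightarrow> odd p) \<longleftrightarrow>
      (odd c \<longrightarrow> min_odd_run k p \<le> c)"
    by (auto simp: min_odd_run_def elim!: oddE)
  finally show ?thesis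
    using assms part by (simp add: run_partitions_def zs_def)
qed

text \<open>Taking away two copies of the largest part preserves both the parities and the permission of
  its multiplicity, unless the multiplicity is \<open>0\<close> or the least permitted odd number.\<close>

lemma run_partitions_Suc:
  "run_partitions k p (Suc L) =
     run_partitions k p L
     \<union> (@) (replicate (min_odd_run k p) (Suc L)) ` run_partitions k (Suc p) L
     \<union> (@) [Suc L, Suc L] ` run_partitions k p (Suc L)" (is "?C = ?A \<union> ?B \<union> ?D")
proof (intro equalityI subsetI)
  let ?r = "\<lambda>c. replicate c (Suc L)"
  fix xs assume xs: "xs \<in> ?C"
  then obtain c ys where xs_eq: "xs = ?r c @ ys" and ys: "ys \<in> partitions_into {..L}"
    by (auto simp: run_partitions_def elim: partition_split_max)
  have ys': "ys \<in> run_partitions k (p + c) L" and c: "odd c \<Longrightarrow> min_odd_run k p \<le> c"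
    using xs run_partitions_replicate[OF ys] by (auto simp: xs_eq)
  have parity: "odd (min_odd_run k p)"
    by (simp add: min_odd_run_def)
  consider "c = 0" | "c = min_odd_run k p" | d where "c = Suc (Suc d)" "odd d \<longrightarrow> min_odd_run k p \<le> d"
  proof (cases "c = 0 \<or> c = min_odd_run k p")
    case False
    have "c \<noteq> 1" using False c by (auto simp: min_odd_run_def split: if_splits)
    then obtain d where d: "c = Suc (Suc d)"
      using False by (metis One_nat_def not0_implies_Suc)
    have "min_odd_run k p \<le> d" if "odd d"
    proof -
      have "min_odd_run k p < c" using c that False d by fastforce
      moreover have "min_odd_run k p \<noteq> Suc d" using parity that by auto
      ultimately show ?thesis using d by linarith
    qed
    with d that(3) show thesis by blast
  qed (use that in auto)
  then show "xs \<in> ?A \<union> ?B \<union> ?D"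
  proof cases
    case 1
    then show ?thesis using ys' by (simp add: xs_eq)
  next
    case 2
    have "run_partitions k (p + c) L = run_partitions k (Suc p) L"
      by (rule run_partitions_cong) (use 2 parity in simp)
    then show ?thesis using ys' by (simp add: xs_eq 2)
  next
    case (3 d)
    have "run_partitions k (p + c) L = run_partitions k (p + d) L"
      by (rule run_partitions_cong) (simp add: 3)
    then have "?r d @ ys \<in> ?C"
      using run_partitions_replicate[OF ys] ys' 3 by blast
    then have "[Suc L, Suc L] @ (?r d @ ys) \<in> ?D" by (rule imageI)
    then show ?thesis by (simp add: xs_eq 3)
  qed
next
  let ?r = "\<lambda>c. replicate c (Suc L)"
  fix xs assume "xs \<in> ?A \<union> ?B \<union> ?D"
  then consider "xs \<in> ?A" | "xs \<in> ?B" | "xs \<in> ?D" by blast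
  then show "xs \<in> ?C"
  proof cases
    case 1
    then have "xs \<in> partitions_into {..L}" by (simp add: run_partitions_def)
    from run_partitions_replicate[OF this, of 0 k p] 1 show ?thesis by simp
  next
    case 2
    then obtain ys where ys: "xs = ?r (min_odd_run k p) @ ys" "ys \<in> run_partitions k (Suc p) L"
      by blast
    then have "ys \<in> partitions_into {..L}" by (simp add: run_partitions_def)
    moreover have "run_partitions k (Suc p) L = run_partitions k (p + min_odd_run k p) L"
      by (rule run_partitions_cong) (simp add: min_odd_run_def)
    ultimately show ?thesis using ys run_partitions_replicate by blast
  next
    case 3
    then obtain zs where zs: "xs = [Suc L, Suc L] @ zs" "zs \<in> ?C" by blast
    then obtain c ys where zs_eq: "zs = ?r c @ ys" and ys: "ys \<in> partitions_into {..L}"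
      by (auto simp: run_partitions_def elim: partition_split_max)
    have "run_partitions k (p + Suc (Suc c)) L = run_partitions k (p + c) L"
      by (rule run_partitions_cong) simp
    then have "?r (Suc (Suc c)) @ ys \<in> ?C"
      using run_partitions_replicate[OF ys, of c k p] run_partitions_replicate[OF ys, of "Suc (Suc c)" k p] zs
      by (auto simp: zs_eq)
    then show ?thesis by (simp add: zs(1) zs_eq)
  qed
qed

text \<open>The two sets differ in the multiplicity of \<open>Suc L\<close>: two copies less than the least permitted
  odd number is odd and no longer permitted.\<close>

lemma run_partitions_Suc_disjoint:
  "(@) (replicate (min_odd_run k p) (Suc L)) ` run_partitions k (Suc p) L
     \<inter> (@) [Suc L, Suc L] ` run_partitions k p (Suc L) = {}"
proof -
  let ?r = "\<lambda>c. replicate c (Suc L)"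
  have False if ys: "ys \<in> partitions_into {..L}" and zs: "zs \<in> run_partitions k p (Suc L)"
    and eq: "?r (min_odd_run k p) @ ys = [Suc L, Suc L] @ zs" for ys zs
  proof -
    from zs obtain c us where zs_eq: "zs = ?r c @ us" and us: "us \<in> partitions_into {..L}"
      by (auto simp: run_partitions_def elim: partition_split_max)
    have zero: "count_list ys (Suc L) = 0" "count_list us (Suc L) = 0"
      using ys us by (auto simp: partitions_into_def count_list_0_iff)
    have count_rep: "count_list (?r c) (Suc L) = c" for c
      by (induction c) auto
    have "min_odd_run k p = Suc (Suc c)"
      using arg_cong[OF eq, of "\<lambda>xs. count_list xs (Suc L)"] zero count_rep by (simp add: zs_eq)
    moreover have "odd (min_odd_run k p)"
      by (simp add: min_odd_run_def)
    ultimately show False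
      using run_partitions_replicate[OF us, of c k p] zs by (simp add: zs_eq)
  qed
  then show ?thesis by (fastforce simp: run_partitions_def)
qed

lemma weight_gf_run_partitions_Suc:
  "(1 - fps_X ^ (2 * Suc L)) * weight_gf sum_list (run_partitions k p (Suc L)) =
     weight_gf sum_list (run_partitions k p L)
     + fps_X ^ (min_odd_run k p * Suc L) * weight_gf sum_list (run_partitions k (Suc p) L)"
proof -
  let ?g = "weight_gf sum_list"
  let ?A = "run_partitions k p L" and ?C = "run_partitions k p (Suc L)"
  let ?B = "(@) (replicate (min_odd_run k p) (Suc L)) ` run_partitions k (Suc p) L"
  let ?D = "(@) [Suc L, Suc L] ` ?C"
  have fin: "finite {xs \<in> Z. sum_list xs = n}" if "Z \<subseteq> ?C" for Z n
    by (rule finite_partition_level) (use that in \<open>auto simp: run_partitions_def partitions_into_def\<close>)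
  have sub: "?A \<union> ?B \<union> ?D \<subseteq> ?C"
    using run_partitions_Suc by blast
  have notin: "Suc L \<notin> set xs" if "xs \<in> ?A" for xs
    using that by (auto simp: run_partitions_def partitions_into_def)
  have "min_odd_run k p \<noteq> 0" by (simp add: min_odd_run_def)
  then have disj1: "?A \<inter> ?B = {}"
    using notin by force
  have disj2: "(?A \<union> ?B) \<inter> ?D = {}"
    using notin run_partitions_Suc_disjoint[of k p L] by force
  have "?g ?C = ?g (?A \<union> ?B \<union> ?D)"
    by (rule arg_cong[OF run_partitions_Suc])
  moreover have "?g (?A \<union> ?B \<union> ?D) = ?g (?A \<union> ?B) + ?g ?D"
    by (rule weight_gf_Un[OF _ _ disj2]; rule fin) (use sub in blast)+
  moreover have "?g (?A \<union> ?B) = ?g ?A + ?g ?B"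
    by (rule weight_gf_Un[OF _ _ disj1]; rule fin) (use sub in blast)+
  moreover have "?g ?B = fps_X ^ (min_odd_run k p * Suc L) * ?g (run_partitions k (Suc p) L)"
    by (rule weight_gf_image) (auto simp: sum_list_replicate inj_on_def)
  moreover have "?g ?D = fps_X ^ (2 * Suc L) * ?g ?C"
    by (rule weight_gf_image) (auto simp: inj_on_def)
  ultimately have "?g ?C = ?g ?A + fps_X ^ (min_odd_run k p * Suc L) * ?g (run_partitions k (Suc p) L)
      + fps_X ^ (2 * Suc L) * ?g ?C"
    by simp
  then show ?thesis
    by (simp only: left_diff_distrib diff_eq_eq mult_1)
qed

definition strict_upto :: "nat \<Rightarrow> nat list set" where
  "strict_upto L = {xs. sorted_wrt (>) xs \<and> set xs \<subseteq> {1..L}}"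

lemma finite_strict_upto: "finite (strict_upto L)"
proof (rule finite_subset)
  have "length xs \<le> L" if "xs \<in> strict_upto L" for xs
  proof -
    have "sorted_wrt (\<lambda>x y. y \<noteq> x) xs"
      using that by (auto simp: strict_upto_def elim: sorted_wrt_mono_rel[rotated])
    then have "distinct xs"
      by (induction xs) auto
    then have "length xs = card (set xs)" by (simp add: distinct_card)
    also have "\<dots> \<le> card {1..L}"
      by (rule card_mono) (use that in \<open>auto simp: strict_upto_def\<close>)
    finally show ?thesis by simp
  qed
  then show "strict_upto L \<subseteq> {xs. set xs \<subseteq> {1..L} \<and> length xs \<le> L}"
    by (auto simp: strict_upto_def)
qed (simp add: finite_lists_length_le)

lemma weight_gf_strict_upto_Suc:
  "weight_gf (alt_sum a b) (strict_upto (Suc L)) =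
     weight_gf (alt_sum a b) (strict_upto L)
     + fps_X ^ (a * Suc L) * weight_gf (alt_sum b a) (strict_upto L)"
proof -
  let ?B = "(#) (Suc L) ` strict_upto L"
  have eq: "strict_upto (Suc L) = strict_upto L \<union> ?B"
  proof (intro equalityI subsetI)
    fix xs assume xs: "xs \<in> strict_upto (Suc L)"
    show "xs \<in> strict_upto L \<union> ?B"
    proof (cases "Suc L \<in> set xs")
      case False
      then show ?thesis using xs by (fastforce simp: strict_upto_def le_Suc_eq)
    next
      case True
      then obtain y ys where ys: "xs = y # ys" by (cases xs) auto
      then have "y = Suc L" "ys \<in> strict_upto L"
        using xs True by (fastforce simp: strict_upto_def)+
      then show ?thesis by (simp add: ys)
    qed
  next
    fix xs assume "xs \<in> strict_upto L \<union> ?B"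
    then show "xs \<in> strict_upto (Suc L)"
      by (fastforce simp: strict_upto_def)
  qed
  have "weight_gf (alt_sum a b) (strict_upto (Suc L))
      = weight_gf (alt_sum a b) (strict_upto L) + weight_gf (alt_sum a b) ?B"
    unfolding eq
    by (rule weight_gf_Un) (auto simp: finite_strict_upto, auto simp: strict_upto_def)
  moreover have "weight_gf (alt_sum a b) ?B = fps_X ^ (a * Suc L) * weight_gf (alt_sum b a) (strict_upto L)"
    by (rule weight_gf_image) auto
  ultimately show ?thesis by simp
qed

text \<open>Stripping pairs of equal parts, which accounts for the product over even numbers, leaves a list
  of distinct parts, each marking an odd multiplicity. Each of them switches the parity, so the
  least permitted odd multiplicities \<open>2 * k + 1\<close> and \<open>1\<close> alternate as weights.\<close>

lemma weight_gf_run_partitions: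
  "(\<Prod>i=1..L. 1 - fps_X ^ (2 * i)) * weight_gf sum_list (run_partitions k p L) =
     weight_gf (alt_sum (min_odd_run k p) (min_odd_run k (Suc p))) (strict_upto L)"
proof (induction L arbitrary: p)
  case 0
  have "xs = []" if "set xs \<subseteq> {..0}" "is_partition xs" for xs
    using that by (cases xs) (auto simp: is_partition_def)
  then have "run_partitions k p 0 = {[]}"
    by (auto simp: run_partitions_def partitions_into_def is_partition_def run_cond_def)
  moreover have "strict_upto 0 = {[]}"
    by (auto simp: strict_upto_def)
  ultimately show ?case by (simp add: weight_gf_singleton)
next
  case (Suc L)
  define E :: "rat fps" where "E = (\<Prod>i=1..L. 1 - fps_X ^ (2 * i))"
  have per: "min_odd_run k (Suc (Suc p)) = min_odd_run k p"
    by (simp add: min_odd_run_def)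
  have "(\<Prod>i=1..Suc L. 1 - fps_X ^ (2 * i)) * weight_gf sum_list (run_partitions k p (Suc L))
     = E * ((1 - fps_X ^ (2 * Suc L)) * weight_gf sum_list (run_partitions k p (Suc L)))"
    by (simp add: E_def mult.assoc)
  also have "\<dots> = E * weight_gf sum_list (run_partitions k p L)
     + fps_X ^ (min_odd_run k p * Suc L) * (E * weight_gf sum_list (run_partitions k (Suc p) L))"
    unfolding weight_gf_run_partitions_Suc by (simp only: distrib_left mult.left_commute)
  finally show ?case
    unfolding weight_gf_strict_upto_Suc E_def Suc.IH per .
qed

text \<open>A strict list has length and entries bounded by its weight, so the bounds \<open>L\<close> and \<open>N\<close> are
  invisible to coefficients of lower order.\<close>

lemma weight_gf_strict_upto_nth:
  assumes "0 < a" "0 < b" "n \<le> L" "n \<le> N"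
  shows "fps_nth (weight_gf (alt_sum a b) (strict_upto L)) n
    = fps_nth (\<Sum>r\<le>N. stair_gf a (a + b) r) n"
proof -
  let ?R = "\<lambda>r. {xs \<in> strict_of_length r. alt_sum a b xs = n}"
  have "{xs \<in> strict_upto L. alt_sum a b xs = n} = (\<Union>r\<le>N. ?R r)"
  proof (intro equalityI subsetI)
    fix xs assume xs: "xs \<in> {xs \<in> strict_upto L. alt_sum a b xs = n}"
    then have pos: "\<forall>x\<in>set xs. 0 < x" by (auto simp: strict_upto_def)
    then have "length xs \<le> sum_list xs"
      by (induction xs) (simp_all add: Suc_le_eq add_less_le_mono)
    then have "length xs \<le> N"
      using alt_sum_ge[OF assms(1,2), of xs] xs assms(4) by simp
    then show "xs \<in> (\<Union>r\<le>N. ?R r)"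
      using xs pos by (auto simp: strict_upto_def strict_of_length_def)
  next
    fix xs assume "xs \<in> (\<Union>r\<le>N. ?R r)"
    then have xs: "sorted_wrt (>) xs" "0 \<notin> set xs" "alt_sum a b xs = n"
      by (auto simp: strict_of_length_def)
    have "x \<in> {1..L}" if "x \<in> set xs" for x
    proof -
      have "x \<le> sum_list xs" using that by (simp add: member_le_sum_list)
      moreover have "x \<noteq> 0" using xs(2) that by metis
      ultimately show ?thesis using alt_sum_ge[OF assms(1,2), of xs] xs(3) assms(3) by simp
    qed
    then show "xs \<in> {xs \<in> strict_upto L. alt_sum a b xs = n}"
      using xs by (auto simp: strict_upto_def)
  qed
  moreover have "finite (?R r)" for r
    by (rule finite_subset[OF _ finite_alt_sum_level[OF assms(1,2), of r n]])
      (auto simp: strict_of_length_def)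
  moreover have "?R r \<inter> ?R s = {}" if "r \<noteq> s" for r s
    using that by (auto simp: strict_of_length_def)
  ultimately have "card {xs \<in> strict_upto L. alt_sum a b xs = n} = (\<Sum>r\<le>N. card (?R r))"
    using card_UN_disjoint[of "{..N}" ?R] by simp
  then show ?thesis
    by (simp add: weight_gf_nth fps_sum_nth flip: weight_gf_strict_of_length[OF assms(1,2)])
qed

section \<open>Comparison of the two counts\<close>

lemma allowed_part_iff: "allowed_part k m \<longleftrightarrow> even m \<or> (2 * k + 2) dvd Suc m"
proof -
  have "[int m = - 1] (mod int (2 * k + 2)) \<longleftrightarrow> int (2 * k + 2) dvd int (Suc m)"
    by (simp add: cong_iff_dvd_diff add.commute)
  then show ?thesis by (simp only: allowed_part_def int_dvd_int_iff)
qed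

text \<open>The cutoff is a multiple of \<open>2 * k + 2\<close>, so both progressions run through whole periods and
  the product below factors without leftover terms.\<close>

lemma allowed_parts_upto:
  "{m \<in> {1..(2 * k + 2) * T}. allowed_part k m}
     = (\<lambda>i. 2 * i) ` {1..(k + 1) * T} \<union> (\<lambda>t. 2 * k + 1 + (2 * k + 2) * t) ` {..<T}"
  (is "?A = ?E \<union> ?O")
proof (intro equalityI subsetI)
  fix m assume m: "m \<in> ?A"
  show "m \<in> ?E \<union> ?O"
  proof (cases "even m")
    case True
    then obtain i where "m = 2 * i" by (rule evenE)
    then show ?thesis using m by (auto simp: algebra_simps)
  next
    case False
    with m have "(2 * k + 2) dvd Suc m" by (simp add: allowed_part_iff)
    then obtain s where s: "Suc m = (2 * k + 2) * s" by (rule dvdE)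
    then obtain t where t: "s = Suc t" by (cases s) auto
    have "m < (2 * k + 2) * T" using m False by (auto simp: le_less)
    then have "(2 * k + 2) * s \<le> (2 * k + 2) * T" using s by linarith
    then have "s \<le> T" by (simp only: mult_le_cancel1)
    then have "t < T" using t by simp
    moreover have "m = 2 * k + 1 + (2 * k + 2) * t" using s t by simp
    ultimately show ?thesis by blast
  qed
next
  fix m assume "m \<in> ?E \<union> ?O"
  then consider i where "m = 2 * i" "i \<in> {1..(k + 1) * T}"
    | t where "m = 2 * k + 1 + (2 * k + 2) * t" "t < T" by auto
  then show "m \<in> ?A"
  proof cases
    case 1
    then show ?thesis by (simp add: allowed_part_iff algebra_simps)
  next
    case 2
    have "Suc m = (2 * k + 2) * Suc t" using 2 by simp
    moreover have "(2 * k + 2) * Suc t \<le> (2 * k + 2) * T"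
      using 2 by (intro mult_left_mono) auto
    moreover have "m \<in> {1..Suc m}" using 2(1) by simp
    moreover have "(2 * k + 2) dvd Suc m" unfolding \<open>Suc m = _\<close> by (rule dvd_triv_left)
    ultimately show ?thesis unfolding allowed_part_iff by simp
  qed
qed

lemma prod_allowed_parts:
  "(\<Prod>m\<in>{m \<in> {1..(2 * k + 2) * T}. allowed_part k m}. 1 - fps_X ^ m :: rat fps) =
     (\<Prod>i=1..(k + 1) * T. 1 - fps_X ^ (2 * i)) *
     (\<Prod>t<T. 1 - fps_X ^ (2 * k + 1 + (2 * k + 2) * t))"
proof -
  let ?E = "(\<lambda>i. 2 * i) ` {1..(k + 1) * T}"
  let ?O = "(\<lambda>t. 2 * k + 1 + (2 * k + 2) * t) ` {..<T}"
  have "even x" if "x \<in> ?E" for x using that by auto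
  moreover have "odd x" if "x \<in> ?O" for x using that by auto
  ultimately have disj: "?E \<inter> ?O = {}" by blast
  have "inj_on (\<lambda>i::nat. 2 * i) {1..(k + 1) * T}"
    by (simp add: inj_on_def)
  moreover have "inj_on (\<lambda>t. 2 * k + 1 + (2 * k + 2) * t) {..<T}"
    by (rule inj_onI) (simp only: add_left_cancel mult_cancel1, simp)
  ultimately show ?thesis
    unfolding allowed_parts_upto by (subst prod.union_disjoint) (use disj in \<open>simp_all only: finite_imageI finite_atLeastAtMost finite_lessThan prod.reindex comp_def\<close>)
qed

abbreviation allowed_upto :: "nat \<Rightarrow> nat \<Rightarrow> nat set" where
  "allowed_upto k M \<equiv> {m \<in> {1..M}. allowed_part k m}"

lemma cond_P_coeff:
  assumes "n \<le> M"
  shows "of_nat (card {xs \<in> partitions_of n. cond_P k xs})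
    = fps_nth (\<Prod>m\<in>allowed_upto k M. inverse (1 - fps_X ^ m) :: rat fps) n"
proof -
  have "{xs \<in> partitions_of n. cond_P k xs} = {xs \<in> partitions_into (allowed_upto k M). sum_list xs = n}"
    using assms member_le_sum_list
    by (fastforce simp: partitions_of_def partitions_into_def cond_P_def is_partition_def)
  then show ?thesis
    by (simp add: weight_gf_partitions_into[symmetric] weight_gf_nth)
qed

lemma cond_C_coeff:
  assumes "n \<le> L"
  shows "of_nat (card {xs \<in> partitions_of n. cond_C k xs})
    = fps_nth (weight_gf sum_list (run_partitions k 0 L)) n"
proof -
  have "{xs \<in> partitions_of n. cond_C k xs} = {xs \<in> run_partitions k 0 L. sum_list xs = n}"
    using assms member_le_sum_list
    by (fastforce simp: partitions_of_def partitions_into_def run_partitions_def run_cond_def cond_C_def)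
  then show ?thesis by (simp add: weight_gf_nth)
qed

text \<open>Modulo \<open>X ^ (n + 1)\<close> both generating functions are inverse to the product of \<open>1 - X ^ m\<close> over the
  allowed parts: the even factors come from the stripped pairs, the odd ones from the alternating
  strict lists.\<close>

lemma card_cond_P_eq_cond_C:
  "card {xs \<in> partitions_of n. cond_P k xs} = card {xs \<in> partitions_of n. cond_C k xs}"
proof -
  let ?K = "2 * k + 2" and ?a = "2 * k + 1" and ?T = "n + 1"
  let ?L = "(k + 1) * ?T" and ?M = "?K * ?T"
  define Ev :: "rat fps" where "Ev = (\<Prod>i=1..?L. 1 - fps_X ^ (2 * i))"
  define Od :: "rat fps" where "Od = (\<Prod>t<?T. 1 - fps_X ^ (?a + ?K * t))"
  define P :: "rat fps" where "P = (\<Prod>m\<in>allowed_upto k ?M. inverse (1 - fps_X ^ m))"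
  define C where "C = weight_gf sum_list (run_partitions k 0 ?L)"
  define D where "D = weight_gf (alt_sum ?a 1) (strict_upto ?L)"
  define S where "S = (\<Sum>r\<le>2 * n. stair_gf ?a ?K r)"
  have le: "n \<le> ?L" "n \<le> ?M"
    by simp_all
  have EC: "Ev * C = D"
    using weight_gf_run_partitions[of ?L k 0] by (simp add: Ev_def C_def D_def min_odd_run_def)
  have "P * (Ev * Od) = (\<Prod>m\<in>allowed_upto k ?M. inverse (1 - fps_X ^ m) * (1 - fps_X ^ m))"
    unfolding P_def Ev_def Od_def prod_allowed_parts[symmetric] prod.distrib ..
  also have "\<dots> = 1"
    by (rule prod.neutral) (auto simp: one_minus_fps_X_power_inverse mult.commute)
  finally have PEO: "P * (Ev * Od) = 1" .
  have "fps_nth D i = fps_nth S i" if "i \<le> n" for i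
    using weight_gf_strict_upto_nth[of ?a 1 i ?L "2 * n"] that le
    by (simp add: D_def S_def)
  then have DS: "fps_X ^ Suc n dvd D - S"
    by (simp add: fps_X_power_dvd_iff del: power_Suc)
  have OS: "fps_X ^ Suc n dvd Od * S - 1"
    unfolding Od_def S_def by (rule stair_gf_infinite_product) simp_all
  have "P * (Od * (D - S) + (Od * S - 1)) = P * (Od * D) - P"
    by (simp add: algebra_simps)
  also have "P * (Od * D) = (P * (Ev * Od)) * C"
    unfolding EC[symmetric] by (simp only: mult_ac)
  also have "\<dots> = C" by (simp only: PEO mult_1)
  finally have "C - P = P * (Od * (D - S) + (Od * S - 1))" ..
  then have "fps_X ^ Suc n dvd C - P"
    using DS OS by (simp only: dvd_add dvd_mult)
  then have "fps_nth C n = fps_nth P n"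
    by (simp add: fps_X_power_dvd_iff del: power_Suc)
  then show ?thesis
    using cond_P_coeff[OF le(2), of k] cond_C_coeff[OF le(1), of k]
    unfolding C_def P_def by (metis of_nat_eq_iff)
qed

lemma has_prod_cond_P:
  "(\<lambda>m. if allowed_part k (Suc m) then inverse (1 - fps_X ^ Suc m) else 1 :: rat fps)
     has_prod Abs_fps (\<lambda>n. of_nat (card {xs \<in> partitions_of n. cond_P k xs}))"
  (is "?f has_prod ?F")
proof -
  have partial: "(\<Prod>i\<le>N. ?f i) = (\<Prod>m\<in>allowed_upto k (Suc N). inverse (1 - fps_X ^ m))" for N
  proof -
    have "(\<Prod>i\<le>N. ?f i) = (\<Prod>m\<in>Suc ` {..N}. if allowed_part k m then inverse (1 - fps_X ^ m) else 1)"
      by (simp add: prod.reindex)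
    also have "Suc ` {..N} = {1..Suc N}"
      by (simp add: image_Suc_atMost)
    finally show ?thesis
      by (simp only: prod.inter_filter[OF finite_atLeastAtMost])
  qed
  have "(\<lambda>N. \<Prod>i\<le>N. ?f i) \<longlonglongrightarrow> ?F"
  proof (rule tendsto_fpsI)
    fix n
    have "fps_nth (\<Prod>i\<le>N. ?f i) n = fps_nth ?F n" if "n \<le> N" for N
      unfolding partial using cond_P_coeff[of n "Suc N" k] that by simp
    then show "\<forall>\<^sub>F N in sequentially. fps_nth (\<Prod>i\<le>N. ?f i) n = fps_nth ?F n"
      by (rule eventually_sequentiallyI)
  qed
  moreover have "?F \<noteq> 0"
  proof -
    have "[] \<in> {xs \<in> partitions_of 0. cond_P k xs}"
      by (simp add: partitions_of_def is_partition_def cond_P_def)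
    then have "card {xs \<in> partitions_of 0. cond_P k xs} \<noteq> 0"
      using finite_partitions_of[of 0] by auto
    then have "fps_nth ?F 0 \<noteq> 0" by simp
    then show ?thesis by (metis fps_zero_nth)
  qed
  ultimately show ?thesis
    unfolding has_prod_def raw_has_prod_def add_0_right by blast
qed

theorem mainTheorem4:
  fixes k :: nat
  assumes "k \<ge> 1"
  shows "(\<forall>n. card {xs \<in> partitions_of n. cond_P k xs} = card {xs \<in> partitions_of n. cond_S k xs}) \<and>
    (\<forall>xs. is_partition xs \<longrightarrow>
       (adjacency_condition k (xs @ [0]) \<longleftrightarrow> adjacency_condition k xs \<and> initial_condition k xs)) \<and>
    (\<lambda>m. if allowed_part k (Suc m) then inverse (1 - fps_X ^ Suc m) else 1 :: rat fps)
       has_prod Abs_fps (\<lambda>n. of_nat (card {xs \<in> partitions_of n. cond_P k xs})) \<and>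
    (\<forall>m. allowed_part k (m + (2 * k + 2)) \<longleftrightarrow> allowed_part k m) \<and>
    (\<forall>xs. is_partition xs \<longrightarrow> (cond_S k xs \<longleftrightarrow> cond_C k (conjugate_partition xs)))"
proof (intro conjI allI impI)
  show "card {xs \<in> partitions_of n. cond_P k xs} = card {xs \<in> partitions_of n. cond_S k xs}" for n
    by (simp only: card_cond_P_eq_cond_C card_cond_S_eq_cond_C)
  show "allowed_part k (m + (2 * k + 2)) \<longleftrightarrow> allowed_part k m" for m
    unfolding allowed_part_iff add_Suc[symmetric] dvd_add_triv_right_iff by simp
qed (simp_all only: adjacency_condition_append_0_iff has_prod_cond_P cond_S_iff_cond_C)

end
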